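(* Fix $d_{\max}\in[0,1)$ and $K\in\mathcal{K}$. Starting from $V_K(0)=V_0>0$, the LTI policy with gain $K$ satisfies $d_K^\star\le d_{\max}$ for every return path in $\mathcal{X}^N$ if and only if $$h(K)\le 1-(1-d_{\max})^{1/N},$$ where $h(K)=\sigma_{\mathcal{X}}(-K)+\varepsilon^\top|K|$.
   Context: Fix $N\ge1$, $m\ge1$, $V_0>0$, a cost vector $\varepsilon\in\mathbb{R}_+^m$ (componentwise nonnegative) and a nonempty compact set $\mathcal{X}\subset\mathbb{R}^m$ (time-invariant return support). $|K|$ is the vector of componentwise absolute values; $\sigma_{\mathcal{X}}(z):=\sup_{x\in\mathcal{X}}z^\top x$. Admissible gain set: $\mathcal{K}:=\{K\in\mathbb{R}^m:\sigma_{\mathcal{X}}(-K)+\varepsilon^\top|K|\le1\}$. LTI policy with gain $K$: the control is $u_K(k)=KV_K(k)$; along a return path $(x(0),\dots,x(N-1))\in\mathcal{X}^N$ the account value satisfies $V_K(0)=V_0$, $V_K(k+1)=(1+K^\top x(k)-\varepsilon^\top|K|)V_K(k)$. Maximum percentage drawdown along the path: $d_K^\star:=\max_{0\le k\le N}d_K(k)$, where $d_K(k):=\dfrac{\max_{0\le i\le k}V_K(i)-V_K(k)}{\max_{0\le i\le k}V_K(i)}$. *)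

theory Defs
  imports "HOL-Analysis.Analysis"
begin

text \<open>
  Vectors in dimension \<open>m\<close> are elements of \<open>real ^ 'm\<close>. The orders \<open>\<le>\<close> and the absolute value
  \<open>\<bar>K\<bar>\<close> on this type are the library's componentwise ones.
\<close>

text \<open>The supremum is the usual one whenever \<open>X\<close> is nonempty and bounded.\<close>

definition support_fun :: "(real ^ 'm) set \<Rightarrow> real ^ 'm \<Rightarrow> real" where
  "support_fun X z = (SUP x\<in>X. z \<bullet> x)"

definition worst_case_loss :: "(real ^ 'm) set \<Rightarrow> real ^ 'm \<Rightarrow> real ^ 'm \<Rightarrow> real" where
  "worst_case_loss X \<epsilon> K = support_fun X (- K) + \<epsilon> \<bullet> \<bar>K\<bar>"

definition admissible_gains :: "(real ^ 'm) set \<Rightarrow> real ^ 'm \<Rightarrow> (real ^ 'm) set" where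
  "admissible_gains X \<epsilon> = {K. support_fun X (- K) + \<epsilon> \<bullet> \<bar>K\<bar> \<le> 1}"

text \<open>A return path of length \<open>N\<close> is a sequence of which only the entries \<open>x 0, \<dots>, x (N - 1)\<close> matter.\<close>

definition return_path :: "(real ^ 'm) set \<Rightarrow> nat \<Rightarrow> (nat \<Rightarrow> real ^ 'm) \<Rightarrow> bool" where
  "return_path X N x \<longleftrightarrow> (\<forall>k<N. x k \<in> X)"

text \<open>
  Account value under the linear time-invariant control \<open>u(k) = V(k) K\<close>, for proportional
  costs \<open>\<epsilon>\<close> and initial value \<open>V0\<close>.
\<close>

primrec account_value ::
    "real ^ 'm \<Rightarrow> real \<Rightarrow> real ^ 'm \<Rightarrow> (nat \<Rightarrow> real ^ 'm) \<Rightarrow> nat \<Rightarrow> real" where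
  "account_value \<epsilon> V0 K x 0 = V0"
| "account_value \<epsilon> V0 K x (Suc k) = (1 + K \<bullet> x k - \<epsilon> \<bullet> \<bar>K\<bar>) * account_value \<epsilon> V0 K x k"

definition running_max :: "(nat \<Rightarrow> real) \<Rightarrow> nat \<Rightarrow> real" where
  "running_max V k = (MAX i\<in>{0..k}. V i)"

definition drawdown :: "(nat \<Rightarrow> real) \<Rightarrow> nat \<Rightarrow> real" where
  "drawdown V k = (running_max V k - V k) / running_max V k"

definition max_drawdown :: "(nat \<Rightarrow> real) \<Rightarrow> nat \<Rightarrow> real" where
  "max_drawdown V N = (MAX k\<in>{0..N}. drawdown V k)"

end

theory Submission
  imports Defs
begin

text \<open>
  Each step multiplies the account value by at least \<open>1 - h(K) \<ge> 0\<close>, and compactness of the return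
  support provides a return attaining this factor. The drawdown bound says that
  \<open>V k \<ge> (1 - d) V i\<close> whenever \<open>i \<le> k \<le> N\<close>. The path repeating the worst return forces
  \<open>(1 - h(K))^N \<ge> 1 - d\<close>; conversely, if \<open>1 - h(K) \<ge> q\<close> with \<open>q = (1 - d)^(1/N) \<le> 1\<close>, then
  \<open>V k \<ge> q^(k - i) V i \<ge> q^N V i = (1 - d) V i\<close> on every path.
\<close>

text \<open>Positivity of \<open>V 0\<close> alone makes the running maximum positive, so the
  quotient can be cleared whatever the signs of the later values. Since \<open>1 - d > 0\<close>,
  the bound on the maximum then splits into one bound per index.\<close>

lemma drawdown_le_iff:
  assumes "V 0 > 0" and "d < 1"
  shows "drawdown V k \<le> d \<longleftrightarrow> (\<forall>i\<le>k. (1 - d) * V i \<le> V k)"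
proof -
  have "V 0 \<le> running_max V k"
    unfolding running_max_def by (rule Max_ge) auto
  then have pos: "running_max V k > 0"
    using assms by linarith
  have "drawdown V k \<le> d \<longleftrightarrow> running_max V k \<le> V k / (1 - d)"
    unfolding drawdown_def using pos assms by (simp add: field_simps)
  also have "\<dots> \<longleftrightarrow> (\<forall>i\<le>k. V i \<le> V k / (1 - d))"
    unfolding running_max_def by auto
  also have "\<dots> \<longleftrightarrow> (\<forall>i\<le>k. (1 - d) * V i \<le> V k)"
    using assms by (simp add: field_simps)
  finally show ?thesis .
qed

lemma max_drawdown_le_iff:
  assumes "V 0 > 0" and "d < 1"
  shows "max_drawdown V N \<le> d \<longleftrightarrow> (\<forall>k\<le>N. \<forall>i\<le>k. (1 - d) * V i \<le> V k)"
proof -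
  have "max_drawdown V N \<le> d \<longleftrightarrow> (\<forall>k\<le>N. drawdown V k \<le> d)"
    unfolding max_drawdown_def by auto
  then show ?thesis
    using assms by (simp add: drawdown_le_iff)
qed

text \<open>Compactness makes the image of \<open>X\<close> under the linear functional bounded
  above, so the supremum dominates each of its values.\<close>

lemma growth_factor_ge:
  assumes "compact X" and "x \<in> X"
  shows "1 - worst_case_loss X \<epsilon> K \<le> 1 + K \<bullet> x - \<epsilon> \<bullet> \<bar>K\<bar>"
proof -
  have "compact ((\<lambda>x. - K \<bullet> x) ` X)"
    using assms by (intro compact_continuous_image continuous_intros)
  then have "bdd_above ((\<lambda>x. - K \<bullet> x) ` X)"
    by (intro bounded_imp_bdd_above compact_imp_bounded)
  then have "- K \<bullet> x \<le> support_fun X (- K)"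
    unfolding support_fun_def using assms by (intro cSUP_upper)
  then show ?thesis
    by (simp add: worst_case_loss_def)
qed

text \<open>A continuous functional attains its supremum on a nonempty compact set; a maximizer of
  \<open>- K \<bullet> x\<close> is a worst return.\<close>

lemma growth_factor_attained:
  assumes "compact X" and "X \<noteq> {}"
  obtains x where "x \<in> X" and "1 + K \<bullet> x - \<epsilon> \<bullet> \<bar>K\<bar> = 1 - worst_case_loss X \<epsilon> K"
proof -
  have "continuous_on X (\<lambda>x. - K \<bullet> x)"
    by (intro continuous_intros)
  then obtain x where x: "x \<in> X" "\<And>y. y \<in> X \<Longrightarrow> - K \<bullet> y \<le> - K \<bullet> x"
    using continuous_attains_sup[OF assms] by metis
  then have "support_fun X (- K) = - K \<bullet> x"
    unfolding support_fun_def by (intro cSup_eq_maximum) auto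
  then show thesis
    using x by (intro that[of x]) (simp_all add: worst_case_loss_def)
qed

lemma account_value_const:
  "account_value \<epsilon> V0 K (\<lambda>_. x) k = (1 + K \<bullet> x - \<epsilon> \<bullet> \<bar>K\<bar>) ^ k * V0"
  by (induction k) auto

lemma account_value_nonneg:
  assumes "V0 \<ge> 0" and "\<And>j. j < k \<Longrightarrow> 0 \<le> 1 + K \<bullet> x j - \<epsilon> \<bullet> \<bar>K\<bar>"
  shows "account_value \<epsilon> V0 K x k \<ge> 0"
  using assms(2) by (induction k) (auto simp: assms(1))

text \<open>Compounds the one-step bound from time \<open>i\<close> to time \<open>k\<close>, by
  induction on \<open>k\<close> starting at \<open>i\<close>.\<close>

lemma account_value_growth:
  assumes "V0 \<ge> 0" and "q \<ge> 0"
    and "\<And>j. j < k \<Longrightarrow> q \<le> 1 + K \<bullet> x j - \<epsilon> \<bullet> \<bar>K\<bar>" and "i \<le> k"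
  shows "q ^ (k - i) * account_value \<epsilon> V0 K x i \<le> account_value \<epsilon> V0 K x k"
  using assms(4,3)
proof (induction k rule: dec_induct)
  case base
  then show ?case by simp
next
  case (step n)
  \<comment> \<open>The bound \<open>q \<le> 1 + K \<bullet> x n - \<epsilon> \<bullet>
    \<bar>K\<bar>\<close> may be multiplied by the current value only if that value is
    nonnegative.\<close>
  have "0 \<le> account_value \<epsilon> V0 K x n"
    using assms(1,2) step.prems by (intro account_value_nonneg) (meson less_Suc_eq order_trans)+
  then have "q * account_value \<epsilon> V0 K x n \<le> account_value \<epsilon> V0 K x (Suc n)"
    using step.prems by (auto intro: mult_right_mono)
  moreover have "q * (q ^ (n - i) * account_value \<epsilon> V0 K x i) \<le> q * account_value \<epsilon> V0 K x n"
    using assms(2) step by (intro mult_left_mono) auto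
  ultimately show ?case
    using step.hyps by (simp add: Suc_diff_le mult.assoc)
qed

theorem proposition5p1:
  fixes N :: nat and V0 d_max :: real
    and \<epsilon> K :: "real ^ 'm" and X :: "(real ^ 'm) set"
  assumes "N \<ge> 1" and "V0 > 0" and "\<epsilon> \<ge> 0"
    and "X \<noteq> {}" and "compact X"
    and "0 \<le> d_max" and "d_max < 1"
    and "K \<in> admissible_gains X \<epsilon>"
  shows "(\<forall>x. return_path X N x \<longrightarrow> max_drawdown (account_value \<epsilon> V0 K x) N \<le> d_max)
    \<longleftrightarrow> worst_case_loss X \<epsilon> K \<le> 1 - (1 - d_max) powr (1 / real N)"
proof -
  define q where "q = (1 - d_max) powr (1 / real N)"
  have q0: "q \<ge> 0" and q1: "q \<le> 1"
    using assms by (auto simp: q_def intro: powr_le1)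
  have qN: "q ^ N = 1 - d_max"
    using assms by (simp add: q_def powr_power)
  have loss_le1: "worst_case_loss X \<epsilon> K \<le> 1"
    using assms(8) by (simp add: admissible_gains_def worst_case_loss_def)
  have mdd: "max_drawdown (account_value \<epsilon> V0 K x) N \<le> d_max \<longleftrightarrow>
      (\<forall>k\<le>N. \<forall>i\<le>k. (1 - d_max) * account_value \<epsilon> V0 K x i \<le> account_value \<epsilon> V0 K x k)" for x
    using assms by (intro max_drawdown_le_iff) auto
  have "(\<forall>x. return_path X N x \<longrightarrow> max_drawdown (account_value \<epsilon> V0 K x) N \<le> d_max)
    \<longleftrightarrow> q \<le> 1 - worst_case_loss X \<epsilon> K"
  proof
    assume L: "\<forall>x. return_path X N x \<longrightarrow> max_drawdown (account_value \<epsilon> V0 K x) N \<le> d_max"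
    obtain x where x: "x \<in> X" "1 + K \<bullet> x - \<epsilon> \<bullet> \<bar>K\<bar> = 1 - worst_case_loss X \<epsilon> K"
      using growth_factor_attained assms(4,5) by blast
    have "max_drawdown (account_value \<epsilon> V0 K (\<lambda>_. x)) N \<le> d_max"
      using L x(1) by (simp add: return_path_def)
    \<comment> \<open>On the constant worst path the pair \<open>i = 0\<close>, \<open>k = N\<close>
      spans all \<open>N\<close> steps, which gives the bound with the full power.\<close>
    then have "(1 - d_max) * account_value \<epsilon> V0 K (\<lambda>_. x) 0 \<le> account_value \<epsilon> V0 K (\<lambda>_. x) N"
      unfolding mdd by blast
    then have "q ^ N \<le> (1 - worst_case_loss X \<epsilon> K) ^ N"
      using assms(2) x(2) by (simp add: account_value_const qN)
    \<comment> \<open>Admissibility makes the right-hand base nonnegative, so with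
      \<open>N \<ge> 1\<close> the \<open>N\<close>-th powers can be compared through their
      bases.\<close>
    then show "q \<le> 1 - worst_case_loss X \<epsilon> K"
      using loss_le1 assms(1) by (simp add: power_mono_iff q0)
  next
    assume R: "q \<le> 1 - worst_case_loss X \<epsilon> K"
    show "\<forall>x. return_path X N x \<longrightarrow> max_drawdown (account_value \<epsilon> V0 K x) N \<le> d_max"
      unfolding mdd
    proof (intro allI impI)
      fix x k i
      assume x: "return_path X N x" and k: "k \<le> N" and i: "i \<le> k"
      have factor: "q \<le> 1 + K \<bullet> x j - \<epsilon> \<bullet> \<bar>K\<bar>" if "j < k" for j
        using R growth_factor_ge[OF assms(5), of "x j"] x that k
        by (force simp: return_path_def intro: order_trans)
      have "0 \<le> account_value \<epsilon> V0 K x i"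
        using factor q0 i assms(2) by (intro account_value_nonneg) (meson less_imp_le less_le_trans order_trans)+
      \<comment> \<open>Powers of \<open>q\<close> decrease because \<open>q \<le> 1\<close>, which
        comes from \<open>0 \<le> d_max\<close>, and \<open>k - i \<le> N\<close>.\<close>
      moreover have "1 - d_max \<le> q ^ (k - i)"
        unfolding qN[symmetric] using q0 q1 k by (intro power_decreasing) auto
      ultimately have "(1 - d_max) * account_value \<epsilon> V0 K x i
          \<le> q ^ (k - i) * account_value \<epsilon> V0 K x i"
        by (rule mult_right_mono[rotated])
      also have "\<dots> \<le> account_value \<epsilon> V0 K x k"
        using factor q0 i assms(2) by (intro account_value_growth) auto
      finally show "(1 - d_max) * account_value \<epsilon> V0 K x i \<le> account_value \<epsilon> V0 K x k" .
    qed
  qed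
  then show ?thesis
    unfolding q_def by (simp add: le_diff_eq add.commute)
qed

end
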